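(* Let $d=2$, let $\mathbf{k}=(k_1,k_2)\in\mathbb{N}_0^2$ and let $\mathcal{C}_{\mathbf{k}}=\{\mathbf{h}\in\mathbb{N}_0^2:\ h_1\le k_1,\ h_2\le k_2,\ h_1h_2=0\}$. Then $$n_A^*(\mathcal{C}_{\mathbf{k}})=(k_1+1)(k_2+1)+1.$$
   Context: $\mathbb{N}_0=\{0,1,2,\dots\}$ and $\mathbb{N}=\{1,2,\dots\}$. For $n\in\mathbb{N}$, $a\equiv_n b$ means $a\equiv b\pmod n$. The mirrored set $\mathcal{M}(\Lambda)$ of $\Lambda\subset\mathbb{N}_0^d$ is the set of all vectors of $\mathbb{Z}^d$ obtained from elements of $\Lambda$ by arbitrary component-wise sign changes. A pair $(n,\mathbf{z})\in\mathbb{N}\times\mathbb{Z}^d$ is admissible for Plan A for $\Lambda$ if $\mathbf{h}\cdot\mathbf{z}\not\equiv_n\mathbf{h}'\cdot\mathbf{z}$ for all $\mathbf{h}\ne\mathbf{h}'\in\mathcal{M}(\Lambda)$. $n_A^*(\Lambda)$ is the smallest $n\in\mathbb{N}$ such that $(n,\mathbf{z})$ is admissible for Plan A for $\Lambda$ for some $\mathbf{z}\in\mathbb{Z}^d$.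
   Formalization: The formula is proved for k₁,k₂ ≥ 1 and for k = (1,0), (0,1); for every other k ∈ ℕ₀² it is false, e.g. k = (0,0) gives n_A^* = 1, not 2, and k = (2,0) gives 5, not 4. *)

theory Defs
  imports "HOL-Analysis.Finite_Cartesian_Product" "HOL-Number_Theory.Cong"
begin

definition int_dot :: "int ^ 'd::finite \<Rightarrow> int ^ 'd \<Rightarrow> int" where
  "int_dot h z = (\<Sum>i\<in>UNIV. h $ i * z $ i)"

definition mirrored :: "(nat ^ 'd::finite) set \<Rightarrow> (int ^ 'd) set" where
  "mirrored \<Lambda> =
     {v. \<exists>h\<in>\<Lambda>. \<exists>\<sigma> :: int ^ 'd. (\<forall>i. \<sigma> $ i \<in> {1, -1}) \<and> v = (\<chi> i. \<sigma> $ i * int (h $ i))}"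

definition admissible_A :: "(nat ^ 'd::finite) set \<Rightarrow> nat \<Rightarrow> int ^ 'd \<Rightarrow> bool" where
  "admissible_A \<Lambda> n z \<longleftrightarrow> n \<ge> 1 \<and>
     (\<forall>h\<in>mirrored \<Lambda>. \<forall>h'\<in>mirrored \<Lambda>. h \<noteq> h' \<longrightarrow> \<not> [int_dot h z = int_dot h' z] (mod int n))"

definition n_A_star :: "(nat ^ 'd::finite) set \<Rightarrow> nat" where
  "n_A_star \<Lambda> = (LEAST n. \<exists>z. admissible_A \<Lambda> n z)"

text \<open>
  The cross set is defined for all \<open>k\<close>, but the formula \<open>(k\<^sub>1 + 1) (k\<^sub>2 + 1) + 1\<close> for its
  \<^const>\<open>n_A_star\<close> fails for some degenerate \<open>k\<close>. If \<open>k\<^sub>2 = 0\<close>, the mirrored set is the segment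
  \<open>{-k\<^sub>1..k\<^sub>1} \<times> {0}\<close>, so \<^const>\<open>n_A_star\<close> is \<open>2 k\<^sub>1 + 1\<close>, which agrees with \<open>k\<^sub>1 + 2\<close> only for
  \<open>k\<^sub>1 = 1\<close>; symmetrically for \<open>k\<^sub>1 = 0\<close>. Hence the formula holds exactly if both components are
  positive or \<open>k\<close> is \<open>(1, 0)\<close> or \<open>(0, 1)\<close>.
\<close>

definition cross_set :: "nat ^ 2 \<Rightarrow> (nat ^ 2) set" where
  "cross_set k = {h. h $ 1 \<le> k $ 1 \<and> h $ 2 \<le> k $ 2 \<and> h $ 1 * h $ 2 = 0}"

end

(* The mirrored cross lies on the two axes, so admissibility of (n, z) makes the differences of points
   of the box {0..k1} x {0..k2} nonzero modulo n; hence the box embeds into Z/n and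
   n >= (k1+1)(k2+1).  Equality would make the embedding onto.  Writing (k1+1) z1 and -z1 as
   images of box points then forces (k1+1) z1 = 0, that is k1 z1 = -z1, which is excluded.
   For n = (k1+1)(k2+1)+1 the vector z = (1, k1+1) works, as k1+1 is a unit modulo n. *)
theory Submission
  imports Defs "HOL-Analysis.Cartesian_Space"
begin

lemma exists_sign_multiple_iff:
  fixes v :: int
  shows "(\<exists>s. s \<in> {1, -1} \<and> v = s * int m) \<longleftrightarrow> nat \<bar>v\<bar> = m"
  by (cases "v \<ge> 0") auto

text \<open>The signs can be chosen one coordinate at a time, so a sign vector carrying
  \<open>h\<close> to \<open>v\<close> exists exactly when \<open>h\<close> is the vector of
  absolute values of \<open>v\<close>. This removes both existential quantifiers from
  \<open>mirrored\<close>.\<close>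

lemma mem_mirrored_iff: "v \<in> mirrored \<Lambda> \<longleftrightarrow> (\<chi> i. nat \<bar>v $ i\<bar>) \<in> \<Lambda>"
proof -
  have "(\<exists>\<sigma> :: int ^ 'a. (\<forall>i. \<sigma> $ i \<in> {1, -1}) \<and> v = (\<chi> i. \<sigma> $ i * int (h $ i)))
      \<longleftrightarrow> h = (\<chi> i. nat \<bar>v $ i\<bar>)" for h :: "nat ^ 'a"
  proof -
    have "(\<exists>\<sigma> :: int ^ 'a. (\<forall>i. \<sigma> $ i \<in> {1, -1}) \<and> v = (\<chi> i. \<sigma> $ i * int (h $ i)))
        \<longleftrightarrow> (\<exists>\<sigma> :: 'a \<Rightarrow> int. \<forall>i. \<sigma> i \<in> {1, -1} \<and> v $ i = \<sigma> i * int (h $ i))"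
      (is "?L \<longleftrightarrow> ?R")
    proof
      assume ?L
      then obtain \<sigma> :: "int ^ 'a" where "\<forall>i. \<sigma> $ i \<in> {1, -1}"
        and "v = (\<chi> i. \<sigma> $ i * int (h $ i))" by blast
      then have "\<forall>i. (\<lambda>i. \<sigma> $ i) i \<in> {1, -1} \<and> v $ i = (\<lambda>i. \<sigma> $ i) i * int (h $ i)" by simp
      then show ?R by blast
    next
      assume ?R
      then obtain \<sigma> where "\<forall>i. \<sigma> i \<in> {1, -1} \<and> v $ i = \<sigma> i * int (h $ i)" by blast
      then have "(\<forall>i. (vec_lambda \<sigma>) $ i \<in> {1, -1})
          \<and> v = (\<chi> i. (vec_lambda \<sigma>) $ i * int (h $ i))"
        by (simp add: vec_eq_iff)
      then show ?L by blast
    qed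
    also have "\<dots> \<longleftrightarrow> (\<forall>i. \<exists>s. s \<in> {1, -1} \<and> v $ i = s * int (h $ i))"
      by (rule choice_iff[symmetric])
    also have "\<dots> \<longleftrightarrow> h = (\<chi> i. nat \<bar>v $ i\<bar>)"
      unfolding exists_sign_multiple_iff by (auto simp: vec_eq_iff)
    finally show ?thesis .
  qed
  then show ?thesis
    unfolding mirrored_def by auto
qed

lemma mem_mirrored_cross_iff:
  "v \<in> mirrored (cross_set k) \<longleftrightarrow>
     \<bar>v $ 1\<bar> \<le> int (k $ 1) \<and> \<bar>v $ 2\<bar> \<le> int (k $ 2) \<and> (v $ 1 = 0 \<or> v $ 2 = 0)"
  by (auto simp: mem_mirrored_iff cross_set_def)

text \<open>Admissibility for the cross in terms of scalars. The clauses are the possible positions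
  of two mirrored points: both on the first axis, both on the second, one on each. In the mixed case
  equality can only happen at the origin.\<close>

definition cross_distinct :: "int \<Rightarrow> int \<Rightarrow> int \<Rightarrow> int \<Rightarrow> int \<Rightarrow> bool" where
  "cross_distinct a b n p q \<longleftrightarrow>
     (\<forall>x x'. \<bar>x\<bar> \<le> a \<longrightarrow> \<bar>x'\<bar> \<le> a \<longrightarrow> [x * p = x' * p] (mod n) \<longrightarrow> x = x') \<and>
     (\<forall>y y'. \<bar>y\<bar> \<le> b \<longrightarrow> \<bar>y'\<bar> \<le> b \<longrightarrow> [y * q = y' * q] (mod n) \<longrightarrow> y = y') \<and>
     (\<forall>x y. \<bar>x\<bar> \<le> a \<longrightarrow> \<bar>y\<bar> \<le> b \<longrightarrow> [x * p = y * q] (mod n) \<longrightarrow> x = 0 \<and> y = 0)"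

lemma cross_distinct_commute: "cross_distinct a b n p q \<Longrightarrow> cross_distinct b a n q p"
  unfolding cross_distinct_def by (auto dest: cong_sym)

lemma admissible_cross_iff:
  "admissible_A (cross_set k) n z \<longleftrightarrow>
     n \<ge> 1 \<and> cross_distinct (int (k $ 1)) (int (k $ 2)) (int n) (z $ 1) (z $ 2)"
  (is "?L \<longleftrightarrow> _ \<and> cross_distinct ?a ?b ?n ?p ?q")
proof
  assume L: ?L
  have inj: "x = x' \<and> y = y'"
    if "\<bar>x\<bar> \<le> ?a" "\<bar>y\<bar> \<le> ?b" "x = 0 \<or> y = 0" "\<bar>x'\<bar> \<le> ?a" "\<bar>y'\<bar> \<le> ?b" "x' = 0 \<or> y' = 0"
      and "[x * ?p + y * ?q = x' * ?p + y' * ?q] (mod ?n)" for x y x' y'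
  proof -
    let ?v = "vector [x, y] :: int ^ 2" and ?v' = "vector [x', y'] :: int ^ 2"
    have "?v \<in> mirrored (cross_set k)" "?v' \<in> mirrored (cross_set k)"
      using that by (simp_all add: mem_mirrored_cross_iff)
    moreover have "[int_dot ?v z = int_dot ?v' z] (mod ?n)"
      using that by (simp add: int_dot_def sum_2)
    ultimately have "?v = ?v'" using L unfolding admissible_A_def by blast
    then show ?thesis by (metis vector_2)
  qed
  show "n \<ge> 1 \<and> cross_distinct ?a ?b ?n ?p ?q"
    unfolding cross_distinct_def
  proof (intro conjI allI impI)
    show "n \<ge> 1" using L by (simp add: admissible_A_def)
  next
    fix x x' assume "\<bar>x\<bar> \<le> ?a" "\<bar>x'\<bar> \<le> ?a" "[x * ?p = x' * ?p] (mod ?n)"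
    then show "x = x'" using inj[of x 0 x' 0] by simp
  next
    fix y y' assume "\<bar>y\<bar> \<le> ?b" "\<bar>y'\<bar> \<le> ?b" "[y * ?q = y' * ?q] (mod ?n)"
    then show "y = y'" using inj[of 0 y 0 y'] by simp
  next
    fix x y assume "\<bar>x\<bar> \<le> ?a" "\<bar>y\<bar> \<le> ?b" "[x * ?p = y * ?q] (mod ?n)"
    then show "x = 0" "y = 0" using inj[of x 0 0 y] by simp_all
  qed
next
  assume R: "n \<ge> 1 \<and> cross_distinct ?a ?b ?n ?p ?q"
  then have "n \<ge> 1" and C: "cross_distinct ?a ?b ?n ?p ?q" by auto
  show ?L
    unfolding admissible_A_def
  proof (intro conjI ballI impI notI)
    show "n \<ge> 1" by fact
  next
    fix h h' assume h: "h \<in> mirrored (cross_set k)" "h' \<in> mirrored (cross_set k)"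
      and "h \<noteq> h'" and "[int_dot h z = int_dot h' z] (mod ?n)"
    then have cong: "[h $ 1 * ?p + h $ 2 * ?q = h' $ 1 * ?p + h' $ 2 * ?q] (mod ?n)"
      by (simp add: int_dot_def sum_2)
    have "h $ 1 = h' $ 1 \<and> h $ 2 = h' $ 2"
    \<comment> \<open>The cases record the axis of each point. The mixed clause of
      \<open>cross_distinct\<close> has the first axis on the left, hence \<open>cong_sym\<close> in
      the third case.\<close>
    proof (cases "h $ 2 = 0"; cases "h' $ 2 = 0")
      assume "h $ 2 = 0" "h' $ 2 = 0"
      then show ?thesis using h cong C
        by (auto simp: mem_mirrored_cross_iff cross_distinct_def)
    next
      assume "h $ 2 = 0" "h' $ 2 \<noteq> 0"
      then show ?thesis using h cong C
        by (auto simp: mem_mirrored_cross_iff cross_distinct_def)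
    next
      assume "h $ 2 \<noteq> 0" "h' $ 2 = 0"
      then show ?thesis using h cong_sym[OF cong] C
        by (auto simp: mem_mirrored_cross_iff cross_distinct_def)
    next
      assume "h $ 2 \<noteq> 0" "h' $ 2 \<noteq> 0"
      then show ?thesis using h cong C
        by (auto simp: mem_mirrored_cross_iff cross_distinct_def)
    qed
    with \<open>h \<noteq> h'\<close> show False by (simp add: vec_eq_iff forall_2)
  qed
qed

text \<open>The condition \<open>a \<ge> 1\<close> puts -1 into the range from -a to a, where the
  final contradiction takes place. Allowing \<open>b = 0\<close> covers k = (1, 0) and, with the
  axes swapped, k = (0, 1).\<close>

lemma cross_distinct_modulus_gt:
  fixes a b n p q :: int
  assumes "cross_distinct a b n p q" and a: "a \<ge> 1" and b: "b \<ge> 0" and n: "n \<ge> 1"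
  shows "n > (a + 1) * (b + 1)"
proof (rule ccontr)
  have X: "x = x'" if "\<bar>x\<bar> \<le> a" "\<bar>x'\<bar> \<le> a" "[x * p = x' * p] (mod n)" for x x'
    using assms(1) that unfolding cross_distinct_def by blast
  have Y: "y = y'" if "\<bar>y\<bar> \<le> b" "\<bar>y'\<bar> \<le> b" "[y * q = y' * q] (mod n)" for y y'
    using assms(1) that unfolding cross_distinct_def by blast
  have XY: "x = 0 \<and> y = 0" if "\<bar>x\<bar> \<le> a" "\<bar>y\<bar> \<le> b" "[x * p = y * q] (mod n)" for x y
    using assms(1) that unfolding cross_distinct_def by blast
  define f where "f = (\<lambda>(x, y). (x * p + y * q) mod n)"
  define B where "B = {0..a} \<times> {0..b}"
  assume "\<not> n > (a + 1) * (b + 1)"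
  then have card: "card {0..<n} \<le> card B"
    using a b n by (simp add: B_def nat_mult_distrib[symmetric])
  have inj: "inj_on f B"
  proof (rule inj_onI, clarsimp simp: f_def B_def)
    fix x y x' y'
    assume bd: "0 \<le> x" "x \<le> a" "0 \<le> y" "y \<le> b" "0 \<le> x'" "x' \<le> a" "0 \<le> y'" "y' \<le> b"
      and eq: "(x * p + y * q) mod n = (x' * p + y' * q) mod n"
    \<comment> \<open>Separating the two axes turns a collision in the box into one between points
      of the cross: coordinates from \<open>{0..a}\<close> differ by at most a, and likewise for
      b.\<close>
    have "[(x - x') * p = (y' - y) * q] (mod n)"
      using eq by (simp add: cong_def[symmetric] cong_iff_dvd_diff algebra_simps)
    then show "x = x' \<and> y = y'" using XY[of "x - x'" "y' - y"] bd by simp linarith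
  qed
  have "f ` B \<subseteq> {0..<n}" using n by (auto simp: f_def B_def)
  then have "f ` B = {0..<n}"
    using card inj by (intro card_seteq) (auto simp: card_image)
  then have rep: "\<exists>x y. 0 \<le> x \<and> x \<le> a \<and> 0 \<le> y \<and> y \<le> b \<and> [t = x * p + y * q] (mod n)" for t
  proof -
    have "t mod n \<in> f ` B" using \<open>f ` B = {0..<n}\<close> n by simp
    then show ?thesis unfolding f_def B_def cong_def by fastforce
  qed
  \<comment> \<open>The first multiple of p beyond the edge of the box.\<close>
  obtain x y where xy: "0 \<le> x" "x \<le> a" "0 \<le> y" "y \<le> b" "[(a + 1) * p = x * p + y * q] (mod n)"
    using rep by blast
  have "[(a + 1 - x) * p = y * q] (mod n)"
    using xy(5) by (simp add: cong_iff_dvd_diff algebra_simps)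
  \<comment> \<open>If x were positive, a + 1 - x would lie between 1 and a, and \<open>XY\<close>
    would force it to be 0. The same argument below, with x' + 1, gives x' = a.\<close>
  then have "x = 0" using XY[of "a + 1 - x" y] xy by (cases "x = 0") auto
  obtain x' y' where xy': "0 \<le> x'" "x' \<le> a" "0 \<le> y'" "y' \<le> b" "[- p = x' * p + y' * q] (mod n)"
    using rep by blast
  have c': "[(x' + 1) * p = (- y') * q] (mod n)"
    using cong_sym[OF xy'(5)] by (simp add: cong_iff_dvd_diff algebra_simps)
  then have "x' = a" using XY[of "x' + 1" "- y'"] xy' by (cases "x' = a") auto
  \<comment> \<open>Both sides are congruent to (a + 1) p. By \<open>Y\<close>, y = -y', and since
    neither y nor y' is negative, both vanish.\<close>
  have "[y * q = (- y') * q] (mod n)"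
    using xy(5) c' \<open>x = 0\<close> \<open>x' = a\<close> by (metis add_0 cong_sym cong_trans mult_zero_left)
  then have "y = 0" using Y[of y "- y'"] xy xy' by auto
  then have "[a * p = (- 1) * p] (mod n)"
    using xy(5) \<open>x = 0\<close> by (simp add: cong_iff_dvd_diff algebra_simps)
  then show False using X[of a "- 1"] a by auto
qed

lemma cong_imp_eq_of_abs_diff_less:
  fixes x y n :: int
  assumes "[x = y] (mod n)" "\<bar>x - y\<bar> < n"
  shows "x = y"
  using assms dvd_imp_le_int[of "x - y" n] by (force simp: cong_iff_dvd_diff)

text \<open>The assumptions \<open>2\<close> keep differences along one axis below the modulus, so
  congruent points there are equal. For \<open>b = 0\<close> they require a < 2, which is where the
  larger degenerate crosses drop out.\<close>

lemma cross_distinct_one_Suc: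
  fixes a b :: int
  assumes a: "a \<ge> 0" and b: "b \<ge> 0"
    and 2: "2 * a < (a + 1) * (b + 1) + 1" "2 * b < (a + 1) * (b + 1) + 1"
  shows "cross_distinct a b ((a + 1) * (b + 1) + 1) 1 (a + 1)"
  unfolding cross_distinct_def
proof (intro conjI allI impI)
  let ?n = "(a + 1) * (b + 1) + 1"
  fix x x' :: int assume "\<bar>x\<bar> \<le> a" "\<bar>x'\<bar> \<le> a" "[x * 1 = x' * 1] (mod ?n)"
  then show "x = x'" using 2 by (intro cong_imp_eq_of_abs_diff_less[of x x' ?n]) auto
next
  let ?n = "(a + 1) * (b + 1) + 1"
  fix y y' :: int assume y: "\<bar>y\<bar> \<le> b" "\<bar>y'\<bar> \<le> b" "[y * (a + 1) = y' * (a + 1)] (mod ?n)"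
  \<comment> \<open>The modulus is one more than a multiple of a + 1.\<close>
  have "coprime (a + 1) ?n"
    by (metis coprime_mult_left_iff coprime_add_one_right)
  then have "[y = y'] (mod ?n)" using y(3) by (simp add: cong_mult_rcancel)
  then show "y = y'" using y 2 by (intro cong_imp_eq_of_abs_diff_less[of y y' ?n]) auto
next
  let ?n = "(a + 1) * (b + 1) + 1"
  fix x y :: int assume xy: "\<bar>x\<bar> \<le> a" "\<bar>y\<bar> \<le> b" "[x * 1 = y * (a + 1)] (mod ?n)"
  have "\<bar>y * (a + 1)\<bar> \<le> b * (a + 1)"
    using xy(2) a by (simp add: abs_mult mult_right_mono)
  \<comment> \<open>The difference is at most a + b (a + 1) = \<open>?n - 2\<close>, so the
    congruence is an equality of integers; a multiple of a + 1 of absolute value at most a is then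
    0.\<close>
  then have "\<bar>x - y * (a + 1)\<bar> < ?n" using xy(1) a by (auto simp: algebra_simps)
  then have eq: "x = y * (a + 1)"
    using xy(3) by (intro cong_imp_eq_of_abs_diff_less[of x "y * (a + 1)" ?n]) auto
  then have "x = 0" using xy(1) a dvd_imp_le_int[of x "a + 1"] by (cases "x = 0") auto
  then show "x = 0" "y = 0" using eq a by auto
qed

theorem mainTheorem3:
  fixes k :: "nat ^ 2"
  assumes nondegenerate: "(k $ 1 \<ge> 1 \<and> k $ 2 \<ge> 1) \<or> k $ 1 + k $ 2 = 1"
  shows "n_A_star (cross_set k) = (k $ 1 + 1) * (k $ 2 + 1) + 1"
  unfolding n_A_star_def
proof (rule Least_equality)
  let ?a = "int (k $ 1)" and ?b = "int (k $ 2)"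
  let ?N = "(k $ 1 + 1) * (k $ 2 + 1) + 1"
  have N: "int ?N = (?a + 1) * (?b + 1) + 1" by (simp add: algebra_simps)
  have "2 * ?a < (?a + 1) * (?b + 1) + 1 \<and> 2 * ?b < (?a + 1) * (?b + 1) + 1"
    using nondegenerate
  proof
    assume pos: "k $ 1 \<ge> 1 \<and> k $ 2 \<ge> 1"
    then have "(?a + 1) * 2 \<le> (?a + 1) * (?b + 1)" by (intro mult_left_mono) auto
    moreover have "2 * (?b + 1) \<le> (?a + 1) * (?b + 1)" using pos by (intro mult_right_mono) auto
    ultimately show ?thesis by auto
  next
    assume "k $ 1 + k $ 2 = 1"
    then have "k $ 1 = 0 \<and> k $ 2 = 1 \<or> k $ 1 = 1 \<and> k $ 2 = 0" by auto
    then show ?thesis by auto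
  qed
  then have "cross_distinct ?a ?b (int ?N) 1 (?a + 1)"
    unfolding N by (intro cross_distinct_one_Suc) auto
  then have "admissible_A (cross_set k) ?N (vector [1, ?a + 1])"
    unfolding admissible_cross_iff vector_2 by simp
  then show "\<exists>z. admissible_A (cross_set k) ?N z" by blast
next
  let ?a = "int (k $ 1)" and ?b = "int (k $ 2)"
  let ?N = "(k $ 1 + 1) * (k $ 2 + 1) + 1"
  fix n assume "\<exists>z. admissible_A (cross_set k) n z"
  then obtain z :: "int ^ 2" where n: "n \<ge> 1" and C: "cross_distinct ?a ?b (int n) (z $ 1) (z $ 2)"
    unfolding admissible_cross_iff by blast
  have "int n > (?a + 1) * (?b + 1)"
  \<comment> \<open>The lower bound wants a positive first side; if \<open>k $ 1 = 0\<close>, the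
    axes are swapped.\<close>
  proof (cases "k $ 1 \<ge> 1")
    case True
    then show ?thesis using cross_distinct_modulus_gt[OF C] n by simp
  next
    case False
    then have "k $ 2 \<ge> 1" using nondegenerate by auto
    then show ?thesis
      using cross_distinct_modulus_gt[OF cross_distinct_commute[OF C]] n by (simp add: mult.commute)
  qed
  then have "int n > int ((k $ 1 + 1) * (k $ 2 + 1))" by (simp add: algebra_simps)
  then show "?N \<le> n" by linarith
qed

end
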